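(* Let $k\ge 3$ be an integer. If a graph $H$ has odd girth (i.e., $H$ contains a cycle and the length of its shortest cycle is odd), then $H$ is not locally $k$-common.
   Context: $\|H\|$ denotes the number of edges of $H$. A graphon is a symmetric measurable $W:[0,1]^2\to[0,1]$; a kernel is a bounded symmetric measurable $U:[0,1]^2\to\mathbb{R}$. The homomorphism density is $t(H,W)=\int_{[0,1]^{V(H)}}\prod_{uv\in E(H)}W(x_u,x_v)\,dx_{V(H)}$. The cut norm of a kernel $U$ is $\|U\|_\square=\sup_{S,T\subseteq[0,1]}\left|\int_{S\times T}U(x,y)\,dx\,dy\right|$, supremum over measurable $S,T$. For an integer $k\ge2$, a graph $H$ is locally $k$-common if there exists $\varepsilon_0>0$ such that $t(H,W_1)+\cdots+t(H,W_k)\ge k^{-\|H\|+1}$ for all graphons $W_1,\dots,W_k$ with $W_1+\cdots+W_k=1$, $\|W_i-1/k\|_\square\le\varepsilon_0/k$ and $\|W_i-1/k\|_\infty\le 1/k$ for all $i\in[k]$. *)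

theory Defs
  imports "HOL-Probability.Probability"
begin

section \<open>Graphs\<close>

definition simple_graph :: "'a set \<Rightarrow> 'a set set \<Rightarrow> bool" where
  "simple_graph V E \<longleftrightarrow> finite V \<and> (\<forall>e\<in>E. e \<subseteq> V \<and> card e = 2)"

definition is_cycle :: "'a set set \<Rightarrow> 'a list \<Rightarrow> bool" where
  "is_cycle E p \<longleftrightarrow> length p \<ge> 3 \<and> distinct p \<and>
     (\<forall>i<length p. {p ! i, p ! (Suc i mod length p)} \<in> E)"

text \<open>Only meaningful for graphs that contain a cycle.\<close>

definition girth :: "'a set set \<Rightarrow> nat" where
  "girth E = (LEAST n. \<exists>p. is_cycle E p \<and> length p = n)"

definition has_odd_girth :: "'a set set \<Rightarrow> bool" where
  "has_odd_girth E \<longleftrightarrow> (\<exists>p. is_cycle E p) \<and> odd (girth E)"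

section \<open>Kernels and graphons\<close>

text \<open>
  Functions on the unit square are represented by functions on the plane, whose values outside
  the unit square are irrelevant. Measurability is Lebesgue measurability.
\<close>

abbreviation unit_square :: "(real \<times> real) set" where
  "unit_square \<equiv> {0..1} \<times> {0..1}"

definition kernel :: "(real \<times> real \<Rightarrow> real) \<Rightarrow> bool" where
  "kernel U \<longleftrightarrow>
     U \<in> borel_measurable (lebesgue_on unit_square) \<and>
     (\<forall>x\<in>{0..1}. \<forall>y\<in>{0..1}. U (x, y) = U (y, x)) \<and>
     (\<exists>B. \<forall>z\<in>unit_square. \<bar>U z\<bar> \<le> B)"

definition graphon :: "(real \<times> real \<Rightarrow> real) \<Rightarrow> bool" where
  "graphon W \<longleftrightarrow> kernel W \<and> (\<forall>z\<in>unit_square. 0 \<le> W z \<and> W z \<le> 1)"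

text \<open>
  The value of \<open>W\<close> at \<open>(x u, x v)\<close> for an edge \<open>e = {u, v}\<close>. By symmetry of \<open>W\<close> it does not
  depend on the order of the end points.
\<close>

definition edge_value :: "(real \<times> real \<Rightarrow> real) \<Rightarrow> ('a \<Rightarrow> real) \<Rightarrow> 'a set \<Rightarrow> real" where
  "edge_value W x e = (THE w. \<exists>u v. e = {u, v} \<and> u \<noteq> v \<and> w = W (x u, x v))"

text \<open>
  The completion is needed: for a Lebesgue measurable \<open>W\<close> the integrand need not be measurable
  with respect to the product sigma-algebra itself.
\<close>

definition hom_density :: "'a set \<Rightarrow> 'a set set \<Rightarrow> (real \<times> real \<Rightarrow> real) \<Rightarrow> real" where
  "hom_density V E W =
     (LINT x|completion (\<Pi>\<^sub>M v\<in>V. lebesgue_on {0..1}). (\<Prod>e\<in>E. edge_value W x e))"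

definition cut_norm :: "(real \<times> real \<Rightarrow> real) \<Rightarrow> real" where
  "cut_norm U =
     (SUP (S, T) \<in> {(S, T). S \<in> sets lebesgue \<and> T \<in> sets lebesgue \<and> S \<subseteq> {0..1} \<and> T \<subseteq> {0..1}}.
        \<bar>LINT z:(S \<times> T)|lebesgue. U z\<bar>)"

definition sup_norm :: "(real \<times> real \<Rightarrow> real) \<Rightarrow> ereal" where
  "sup_norm U = esssup (lebesgue_on unit_square) (\<lambda>z. ereal \<bar>U z\<bar>)"

section \<open>Local commonness\<close>

definition locally_common :: "nat \<Rightarrow> 'a set \<Rightarrow> 'a set set \<Rightarrow> bool" where
  "locally_common k V E \<longleftrightarrow>
     (\<exists>\<epsilon>\<^sub>0>0. \<forall>W :: nat \<Rightarrow> real \<times> real \<Rightarrow> real.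
        (\<forall>i\<in>{1..k}. graphon (W i)) \<longrightarrow>
        (\<forall>z\<in>unit_square. (\<Sum>i=1..k. W i z) = 1) \<longrightarrow>
        (\<forall>i\<in>{1..k}. cut_norm (\<lambda>z. W i z - 1 / real k) \<le> \<epsilon>\<^sub>0 / real k) \<longrightarrow>
        (\<forall>i\<in>{1..k}. sup_norm (\<lambda>z. W i z - 1 / real k) \<le> ereal (1 / real k)) \<longrightarrow>
        (\<Sum>i=1..k. hom_density V E (W i)) \<ge> real k powi (- int (card E) + 1))"

end

theory Submission
  imports Defs
begin

text \<open>
  Let \<open>s\<close> be \<open>1\<close> on one half of the unit interval and \<open>-1\<close> on the other. Expanding the product
  over the edges, the density of \<open>H\<close> in \<open>(1 + c s(x) s(y)) / k\<close> is \<open>k\<close> to the power \<open>-\<parallel>H\<parallel>\<close> times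
  \<open>P(c)\<close>, the sum of \<open>c\<close> to the power \<open>\<parallel>F\<parallel>\<close> over all subgraphs \<open>F\<close> in which every degree is
  even. A nonempty such \<open>F\<close> contains a cycle, so it has at least \<open>g\<close> edges, where \<open>g\<close> is the
  girth, and a shortest cycle attains this bound. Hence \<open>P(c) = 1 + N c\<^sup>g + O(c\<^sup>g\<^sup>+\<^sup>1)\<close> with \<open>N > 0\<close>.
  Taking \<open>c = d, d, -2d, 0, \<dots>, 0\<close> keeps the sum of the \<open>k\<close> graphons equal to \<open>1\<close>, and as \<open>g \<ge> 3\<close>
  is odd, the leading term \<open>(2 - 2\<^sup>g) N d\<^sup>g\<close> is negative. For small \<open>d\<close> the perturbation is small
  even in the supremum norm, so the cut norm constraint is automatic.
\<close>

section \<open>Even subgraphs and cycles\<close>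

text \<open>If positions \<open>i\<close> and \<open>j\<close> gave the same edge crosswise, each
  would be the successor of the other modulo the length, which would then divide 2.\<close>

lemma inj_on_cycle_edges:
  assumes "is_cycle E p"
  shows "inj_on (\<lambda>i. {p ! i, p ! (Suc i mod length p)}) {..<length p}"
proof (rule inj_onI)
  let ?n = "length p"
  fix i j assume ij: "i \<in> {..<?n}" "j \<in> {..<?n}"
    and eq: "{p ! i, p ! (Suc i mod ?n)} = {p ! j, p ! (Suc j mod ?n)}"
  have n: "?n \<ge> 3" and d: "distinct p"
    using assms by (auto simp: is_cycle_def)
  have lt: "Suc i mod ?n < ?n" "Suc j mod ?n < ?n"
    using n by (auto intro!: mod_less_divisor)
  have "i = j \<or> (i = Suc j mod ?n \<and> Suc i mod ?n = j)"
    using eq ij lt nth_eq_iff_index_eq[OF d] by (auto simp: doubleton_eq_iff)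
  then show "i = j"
    using n ij by (auto simp: mod_Suc split: if_splits)
qed

text \<open>The first vertex of a longest path lies on a second edge. By maximality the other end of
  that edge is on the path already, and this closes a cycle.\<close>

lemma cycle_in_graph_without_leaves:
  assumes fin: "finite F" and card2: "\<And>e. e \<in> F \<Longrightarrow> card e = 2" and "F \<noteq> {}"
    and no_leaf: "\<And>v. card {e \<in> F. v \<in> e} \<noteq> 1"
  shows "\<exists>p. is_cycle F p"
proof -
  define path where
    "path p \<longleftrightarrow> distinct p \<and> length p \<ge> 2 \<and> (\<forall>i. Suc i < length p \<longrightarrow> {p ! i, p ! Suc i} \<in> F)" for p
  have finU: "finite (\<Union>F)"
    using fin card2 by (intro finite_Union) (auto intro: card_ge_0_finite)
  have sub: "set p \<subseteq> \<Union>F" if p: "path p" for p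
  proof
    fix x assume "x \<in> set p"
    then obtain i where i: "i < length p" "x = p ! i"
      by (auto simp: in_set_conv_nth)
    show "x \<in> \<Union>F"
    proof (cases "Suc i < length p")
      case True
      then show ?thesis using p i unfolding path_def by blast
    next
      case False
      then obtain j where "i = Suc j" using p i unfolding path_def by (cases i) auto
      then show ?thesis using p i unfolding path_def by blast
    qed
  qed
  have bounded: "length p \<le> card (\<Union>F)" if "path p" for p
    using card_mono[OF finU sub[OF that]] that by (simp add: path_def distinct_card)
  obtain a b where ab: "{a, b} \<in> F" "a \<noteq> b"
    using \<open>F \<noteq> {}\<close> card2 unfolding card_2_iff by fast
  then have "path [a, b]"
    by (auto simp: path_def)
  then obtain p where p: "path p" and longest: "\<And>q. path q \<Longrightarrow> length q \<le> length p"
    using ex_has_greatest_nat[of path "[a, b]" length "Suc (card (\<Union>F))"] bounded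
    by (metis less_Suc_eq_le less_imp_le_nat)
  obtain x y r where xy: "p = x # y # r"
    using p unfolding path_def by (metis Suc_le_length_iff numeral_2_eq_2)
  have "{x, y} \<in> F"
    using p xy unfolding path_def by (auto dest: spec[of _ 0])
  \<comment> \<open>The start \<open>x\<close> is not a leaf, so some edge other than the first edge
    of the path leaves it.\<close>
  moreover have "{e \<in> F. x \<in> e} \<noteq> {{x, y}}"
    using no_leaf[of x] by (metis is_singleton_altdef is_singletonI)
  ultimately obtain e where e: "e \<in> F" "x \<in> e" "e \<noteq> {x, y}"
    by blast
  then obtain w where w: "e = {x, w}" "w \<noteq> x" "w \<noteq> y"
    using card2[OF e(1)] by (auto simp: card_2_iff doubleton_eq_iff)
  have "w \<in> set p"
  proof (rule ccontr)
    assume "w \<notin> set p"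
    then have "path (w # p)"
      using p e w xy unfolding path_def
      by (auto simp: nth_Cons insert_commute split: nat.splits)
    then show False using longest by fastforce
  qed
  then obtain j where j: "j < length p" "p ! j = w"
    by (auto simp: in_set_conv_nth)
  \<comment> \<open>\<open>w\<close> is neither \<open>x\<close> at position 0 nor \<open>y\<close>
    at position 1, so the prefix ending in \<open>w\<close> has at least three vertices.\<close>
  have j2: "j \<ge> 2"
    using j w xy by (auto simp: nth_Cons numeral_2_eq_2 not_less_eq_eq split: nat.splits)
  have "is_cycle F (take (Suc j) p)"
    unfolding is_cycle_def
  proof (intro conjI allI impI)
    fix i assume "i < length (take (Suc j) p)"
    then have i: "i \<le> j" using j by simp
    show "{take (Suc j) p ! i, take (Suc j) p ! (Suc i mod length (take (Suc j) p))} \<in> F"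
    proof (cases "i = j")
      case True
      have "{w, x} \<in> F" using e w by (simp add: insert_commute)
      then show ?thesis using True j xy by (simp add: nth_take del: take_Suc_Cons)
    next
      case False
      then show ?thesis using i j p by (simp add: path_def)
    qed
  qed (use j j2 p in \<open>auto simp: path_def\<close>)
  then show ?thesis by blast
qed

text \<open>For finite graphs these are the elements of the cycle space over the field with two
  elements. Letting \<open>v\<close> range over the whole type avoids a vertex set: vertices on no
  edge have degree 0.\<close>

definition even_subgraph :: "'a set set \<Rightarrow> bool" where
  "even_subgraph F \<longleftrightarrow> (\<forall>v. even (card {e \<in> F. v \<in> e}))"

lemma is_cycle_mono: "is_cycle F p \<Longrightarrow> F \<subseteq> E \<Longrightarrow> is_cycle E p"
  by (auto simp: is_cycle_def)

text \<open>An even degree is never 1, so \<open>F\<close> has no leaf and contains a cycle. Its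
  edges are pairwise distinct, so its length is at most \<open>card F\<close>.\<close>

lemma girth_le_card_even_subgraph:
  assumes G: "simple_graph V E" and FE: "F \<subseteq> E" and F: "F \<noteq> {}" "even_subgraph F"
  shows "girth E \<le> card F"
proof -
  have finE: "finite E"
    using G by (auto simp: simple_graph_def intro: finite_subset[of E "Pow V"])
  have finF: "finite F" using finE FE by (rule finite_subset[rotated])
  have "card {e \<in> F. v \<in> e} \<noteq> 1" for v
    using F(2) unfolding even_subgraph_def by (metis odd_one)
  then obtain p where p: "is_cycle F p"
    using cycle_in_graph_without_leaves[OF finF _ F(1)] G FE unfolding simple_graph_def by blast
  have "girth E \<le> length p"
    unfolding girth_def using is_cycle_mono[OF p FE] by (intro Least_le) blast
  also have "\<dots> = card ((\<lambda>i. {p ! i, p ! (Suc i mod length p)}) ` {..<length p})"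
    by (simp add: card_image inj_on_cycle_edges[OF p])
  also have "\<dots> \<le> card F"
    using p by (intro card_mono finF) (auto simp: is_cycle_def)
  finally show ?thesis .
qed

lemma ex_shortest_cycle:
  assumes "is_cycle E p"
  obtains q where "is_cycle E q" "length q = girth E"
proof -
  have "\<exists>n. \<exists>p. is_cycle E p \<and> length p = n" using assms by blast
  from LeastI_ex[OF this] show thesis
    using that unfolding girth_def by blast
qed

lemma three_le_girth: "is_cycle E p \<Longrightarrow> 3 \<le> girth E"
  by (metis ex_shortest_cycle is_cycle_def)

lemma degree_eq_sum:
  assumes "finite F"
  shows "card {e \<in> F. v \<in> e} = (\<Sum>e\<in>F. if v \<in> e then 1 else 0)"
  using assms by (simp add: sum.If_cases Int_def)

text \<open>The edge set of a shortest cycle works: every vertex occurs equally often as first and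
  as second end of an edge, so its degree is twice a number.\<close>

lemma ex_even_subgraph_card_girth:
  assumes "is_cycle E p"
  obtains F where "F \<subseteq> E" "even_subgraph F" "card F = girth E"
proof -
  obtain q where q: "is_cycle E q" and len: "length q = girth E"
    using ex_shortest_cycle[OF assms] .
  define n where "n = length q"
  define edge where "edge i = {q ! i, q ! (Suc i mod n)}" for i
  have inj: "inj_on edge {..<n}"
    using inj_on_cycle_edges[OF q] unfolding edge_def n_def .
  have n: "n \<ge> 3" and d: "distinct q"
    using q by (auto simp: is_cycle_def n_def)
  have next_ne: "Suc i mod n \<noteq> i" if "i < n" for i
    using n that by (auto simp: mod_Suc)
  have next_lt: "Suc i mod n < n" for i
    using n by (intro mod_less_divisor) auto
  have rot: "bij_betw (\<lambda>i. Suc i mod n) {..<n} {..<n}"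
  \<comment> \<open>Adding \<open>n - 1\<close> steps back by one modulo \<open>n\<close> and avoids
    truncated subtraction at 0.\<close>
  proof (rule bij_betwI[where g = "\<lambda>i. (i + (n - 1)) mod n"])
    show "(\<lambda>i. Suc i mod n) \<in> {..<n} \<rightarrow> {..<n}" "(\<lambda>i. (i + (n - 1)) mod n) \<in> {..<n} \<rightarrow> {..<n}"
      using n by (auto intro!: mod_less_divisor)
    show "(Suc i mod n + (n - 1)) mod n = i" if "i \<in> {..<n}" for i
    proof -
      have "(Suc i mod n + (n - 1)) mod n = (Suc i + (n - 1)) mod n"
        by (rule mod_add_left_eq)
      also have "Suc i + (n - 1) = i + n" using n by simp
      finally show ?thesis using that by simp
    qed
    show "Suc ((i + (n - 1)) mod n) mod n = i" if "i \<in> {..<n}" for i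
      using that n by (simp add: mod_Suc_eq)
  qed
  have "even (card {e \<in> edge ` {..<n}. v \<in> e})" for v
  proof -
    have "card {e \<in> edge ` {..<n}. v \<in> e} = (\<Sum>e\<in>edge ` {..<n}. if v \<in> e then 1 else 0)"
      by (rule degree_eq_sum) simp
    also have "\<dots> = (\<Sum>i<n. if v \<in> edge i then 1 else 0)"
      by (simp add: sum.reindex[OF inj] o_def)
    also have "\<dots> = (\<Sum>i<n. (if q ! i = v then 1 else 0) + (if q ! (Suc i mod n) = v then 1 else 0))"
    proof (rule sum.cong)
      fix i assume i: "i \<in> {..<n}"
      then have "q ! i \<noteq> q ! (Suc i mod n)"
        using next_ne[of i] next_lt[of i] nth_eq_iff_index_eq[OF d] by (auto simp: n_def)
      then show "(if v \<in> edge i then 1 else 0) =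
          (if q ! i = v then 1 else 0) + (if q ! (Suc i mod n) = v then 1 else (0::nat))"
        by (auto simp: edge_def)
    qed simp
    also have "\<dots> = 2 * (\<Sum>i<n. if q ! i = v then 1 else 0)"
      using sum.reindex_bij_betw[OF rot, of "\<lambda>i. if q ! i = v then 1 else (0::nat)"]
      by (simp only: sum.distrib mult_2)
    finally show ?thesis by simp
  qed
  then have "even_subgraph (edge ` {..<n})"
    by (simp add: even_subgraph_def)
  moreover have "edge ` {..<n} \<subseteq> E"
    using q by (auto simp: is_cycle_def edge_def n_def)
  moreover have "card (edge ` {..<n}) = girth E"
    using len card_image[OF inj] by (simp add: n_def)
  ultimately show thesis using that by blast
qed

section \<open>The sign kernel\<close>

definition half_sign :: "real \<Rightarrow> real" where
  "half_sign x = (if x < 1 / 2 then 1 else - 1)"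

definition sign_kernel :: "real \<Rightarrow> real \<times> real \<Rightarrow> real" where
  "sign_kernel c z = 1 + c * (half_sign (fst z) * half_sign (snd z))"

lemma abs_half_sign [simp]: "\<bar>half_sign x\<bar> = 1"
  by (simp add: half_sign_def)

lemma half_sign_borel [measurable]: "half_sign \<in> borel_measurable borel"
  unfolding half_sign_def by measurable

lemma half_sign_lebesgue_on [measurable]: "half_sign \<in> borel_measurable (lebesgue_on S)"
  by (intro measurable_restrict_space1 measurable_completion) simp

lemma sign_kernel_lebesgue_on: "sign_kernel c \<in> borel_measurable (lebesgue_on S)"
proof -
  have "sign_kernel c \<in> borel_measurable (borel \<Otimes>\<^sub>M borel)"
    unfolding sign_kernel_def by measurable
  then have "sign_kernel c \<in> borel_measurable lborel"
    by (simp add: borel_prod)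
  then show ?thesis
    by (intro measurable_restrict_space1 measurable_completion)
qed

lemma half_sign_power: "half_sign x ^ d = (if even d then 1 else half_sign x)"
  by (auto simp: half_sign_def)

lemma prob_space_unit_interval: "prob_space (lebesgue_on {0..1::real})"
  by (rule prob_spaceI) (simp add: emeasure_restrict_space)

lemma integral_half_sign: "(LINT x|lebesgue_on {0..1}. half_sign x) = 0"
proof -
  interpret prob_space "lebesgue_on {0..1::real}" by (rule prob_space_unit_interval)
  have 1: "half_sign x = 2 * indicator {0..<1/2} x - 1" if "x \<in> {0..1}" for x
    using that by (auto simp: half_sign_def indicator_def)
  have m: "{0..<1/2} \<in> sets (lebesgue_on {0..1::real})"
    by (auto simp: sets_restrict_space image_iff intro!: bexI[of _ "{0..<1/2}"])
  have "prob {0..<1/2} = 1 / 2"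
    by (subst measure_restrict_space) auto
  moreover have "integrable (lebesgue_on {0..1}) (indicat_real {0..<1/2::real})"
    using m by (intro integrable_real_indicator) (simp_all add: less_top[symmetric])
  ultimately have "(LINT x|lebesgue_on {0..1::real}. 2 * indicator {0..<1/2} x - 1) = (0::real)"
    using m prob_space
    by (simp add: Bochner_Integration.integral_diff Int_absorb2 subset_iff)
  then show ?thesis
    using Bochner_Integration.integral_cong[OF refl, of "lebesgue_on {0..1}" half_sign "\<lambda>x. 2 * indicator {0..<1/2} x - 1"] 1
    by simp
qed

text \<open>This is the contribution of a vertex of degree \<open>d\<close>: an odd degree makes the
  whole integral vanish.\<close>

lemma integral_half_sign_power:
  "(LINT x|lebesgue_on {0..1}. half_sign x ^ d) = (if even d then 1 else 0)"
proof -
  interpret prob_space "lebesgue_on {0..1::real}" by (rule prob_space_unit_interval)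
  show ?thesis
    using integral_half_sign prob_space by (simp add: half_sign_power)
qed

section \<open>Homomorphism densities of the sign kernel\<close>

text \<open>Swapping the two products gives each vertex the power of its sign to its degree. The
  integral then factors over the vertices.\<close>

lemma integral_prod_half_sign:
  assumes G: "simple_graph V E" and FE: "F \<subseteq> E"
  shows "(LINT x|(\<Pi>\<^sub>M v\<in>V. lebesgue_on {0..1}). (\<Prod>e\<in>F. \<Prod>v\<in>e. half_sign (x v))) =
    (if even_subgraph F then 1 else 0)"
    and "integrable (\<Pi>\<^sub>M v\<in>V. lebesgue_on {0..1}) (\<lambda>x. \<Prod>e\<in>F. \<Prod>v\<in>e. half_sign (x v))"
proof -
  interpret I: prob_space "lebesgue_on {0..1::real}" by (rule prob_space_unit_interval)
  interpret product_sigma_finite "\<lambda>v::'a. lebesgue_on {0..1::real}"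
    by unfold_locales
  have finV: "finite V" using G by (simp add: simple_graph_def)
  have finF: "finite F"
    using G FE by (auto simp: simple_graph_def intro: finite_subset[of F "Pow V"])
  have FV: "\<And>e. e \<in> F \<Longrightarrow> e \<subseteq> V" using G FE by (auto simp: simple_graph_def)
  define deg where "deg v = card {e \<in> F. v \<in> e}" for v
  have swap: "(\<Prod>e\<in>F. \<Prod>v\<in>e. half_sign (x v)) = (\<Prod>v\<in>V. half_sign (x v) ^ deg v)" for x :: "'a \<Rightarrow> real"
  proof -
    have "(\<Prod>e\<in>F. \<Prod>v\<in>e. half_sign (x v)) = (\<Prod>e\<in>F. \<Prod>v | v \<in> V \<and> v \<in> e. half_sign (x v))"
      using FV by (intro prod.cong refl) auto
    also have "\<dots> = (\<Prod>v\<in>V. \<Prod>e | e \<in> F \<and> v \<in> e. half_sign (x v))"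
      by (rule prod.swap_restrict[OF finF finV])
    finally show ?thesis by (simp add: deg_def)
  qed
  have int: "integrable (lebesgue_on {0..1}) (\<lambda>x. half_sign x ^ d)" for d
    by (rule I.integrable_const_bound[of _ 1]) (auto simp: power_abs)
  have "(LINT x|(\<Pi>\<^sub>M v\<in>V. lebesgue_on {0..1}). (\<Prod>e\<in>F. \<Prod>v\<in>e. half_sign (x v))) =
      (\<Prod>v\<in>V. LINT x|lebesgue_on {0..1}. half_sign x ^ deg v)"
    unfolding swap by (rule product_integral_prod[OF finV]) (rule int)
  also have "\<dots> = (if \<forall>v\<in>V. even (deg v) then 1 else 0)"
    using finV by (auto simp: integral_half_sign_power)
  also have "(\<forall>v\<in>V. even (deg v)) \<longleftrightarrow> even_subgraph F"
  proof -
    have "deg v = 0" if "v \<notin> V" for v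
      using FV that finF by (auto simp: deg_def)
    then show ?thesis
      unfolding even_subgraph_def deg_def by (metis even_zero)
  qed
  finally show "(LINT x|(\<Pi>\<^sub>M v\<in>V. lebesgue_on {0..1}). (\<Prod>e\<in>F. \<Prod>v\<in>e. half_sign (x v))) =
    (if even_subgraph F then 1 else 0)" .
  show "integrable (\<Pi>\<^sub>M v\<in>V. lebesgue_on {0..1}) (\<lambda>x. \<Prod>e\<in>F. \<Prod>v\<in>e. half_sign (x v))"
    unfolding swap by (rule product_integrable_prod[OF finV]) (rule int)
qed

text \<open>The product over \<open>e\<close> does not see the order of the end points, so it is the
  unique value that the description picks.\<close>

lemma edge_value_sign_kernel:
  assumes "card e = 2"
  shows "edge_value (\<lambda>z. sign_kernel c z / r) x e = (1 + c * (\<Prod>v\<in>e. half_sign (x v))) / r"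
  unfolding edge_value_def
proof (rule the_equality)
  obtain u v where "e = {u, v}" "u \<noteq> v"
    using assms by (auto simp: card_2_iff)
  then show "\<exists>u v. e = {u, v} \<and> u \<noteq> v \<and>
      (1 + c * (\<Prod>v\<in>e. half_sign (x v))) / r = sign_kernel c (x u, x v) / r"
    by (intro exI[of _ u] exI[of _ v]) (simp add: sign_kernel_def)
qed (auto simp: sign_kernel_def)

lemma hom_density_sign_kernel:
  assumes G: "simple_graph V E"
  shows "hom_density V E (\<lambda>z. sign_kernel c z / r) =
    (\<Sum>F | F \<subseteq> E \<and> even_subgraph F. c ^ card F) / r ^ card E"
proof -
  let ?M = "\<Pi>\<^sub>M v\<in>V. lebesgue_on {0..1::real}"
  define X where "X F x = (\<Prod>e\<in>F. \<Prod>v\<in>e. half_sign (x v))" for F :: "'a set set" and x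
  have finE: "finite E"
    using G by (auto simp: simple_graph_def intro: finite_subset[of E "Pow V"])
  have int: "integrable ?M (X F)" "integral\<^sup>L ?M (X F) = (if even_subgraph F then 1 else 0)"
    if "F \<subseteq> E" for F
    using integral_prod_half_sign[OF G that] unfolding X_def by simp_all
  have expand: "(\<Prod>e\<in>E. edge_value (\<lambda>z. sign_kernel c z / r) x e) =
      (\<Sum>F\<in>Pow E. c ^ card F * X F x) / r ^ card E" for x
  proof -
    have "(\<Prod>e\<in>E. edge_value (\<lambda>z. sign_kernel c z / r) x e) =
        (\<Prod>e\<in>E. (c * (\<Prod>v\<in>e. half_sign (x v)) + 1) / r)"
      using G by (intro prod.cong refl) (simp add: simple_graph_def edge_value_sign_kernel add.commute)
    also have "\<dots> = (\<Prod>e\<in>E. c * (\<Prod>v\<in>e. half_sign (x v)) + 1) / r ^ card E"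
      by (simp add: prod_dividef)
    also have "\<dots> = (\<Sum>F\<in>Pow E. c ^ card F * X F x) / r ^ card E"
      by (simp add: prod_add[OF finE] prod.distrib X_def)
    finally show ?thesis .
  qed
  have intsum: "integrable ?M (\<lambda>x. (\<Sum>F\<in>Pow E. c ^ card F * X F x) / r ^ card E)"
    using int by (intro integrable_divide Bochner_Integration.integrable_sum integrable_mult_right) auto
  have "hom_density V E (\<lambda>z. sign_kernel c z / r) =
      (LINT x|?M. (\<Sum>F\<in>Pow E. c ^ card F * X F x) / r ^ card E)"
    \<comment> \<open>The expanded integrand is measurable for the product sigma-algebra itself, so
      the completion does not change the integral.\<close>
    unfolding hom_density_def expand
    by (rule integral_completion) (rule borel_measurable_integrable[OF intsum])
  also have "\<dots> = (\<Sum>F\<in>Pow E. c ^ card F * (if even_subgraph F then 1 else 0)) / r ^ card E"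
    using int by simp
  also have "(\<Sum>F\<in>Pow E. c ^ card F * (if even_subgraph F then 1 else 0)) =
      (\<Sum>F | F \<subseteq> E \<and> even_subgraph F. c ^ card F)"
    using finE by (intro sum.mono_neutral_cong_right) auto
  finally show ?thesis .
qed

section \<open>Perturbing the constant graphons\<close>

lemma abs_sign_kernel_minus_1 [simp]: "\<bar>sign_kernel c z - 1\<bar> = \<bar>c\<bar>"
  by (simp add: sign_kernel_def abs_mult)

text \<open>The bound on \<open>c\<close> puts the sign kernel between 0 and 2, and dividing by
  \<open>r\<close> brings it below 1.\<close>

lemma graphon_sign_kernel:
  assumes "\<bar>c\<bar> \<le> 1" "r \<ge> 2"
  shows "graphon (\<lambda>z. sign_kernel c z / r)"
proof -
  have "0 \<le> sign_kernel c z / r \<and> sign_kernel c z / r \<le> 1" for z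
    using abs_sign_kernel_minus_1[of c z] assms by (auto simp: divide_le_eq abs_if split: if_splits)
  moreover from this have "\<bar>sign_kernel c z / r\<bar> \<le> 1" for z
    by (metis abs_of_nonneg surj_pair)
  moreover have "sign_kernel c (x, y) = sign_kernel c (y, x)" for x y
    by (simp add: sign_kernel_def mult_ac)
  ultimately show ?thesis
    unfolding graphon_def kernel_def
    by (intro conjI ballI exI[of _ 1]) (simp_all add: borel_measurable_divide sign_kernel_lebesgue_on)
qed

lemma sup_norm_le:
  assumes "U \<in> borel_measurable (lebesgue_on unit_square)" "\<And>z. z \<in> unit_square \<Longrightarrow> \<bar>U z\<bar> \<le> b"
  shows "sup_norm U \<le> ereal b"
  unfolding sup_norm_def
  using assms by (intro esssup_I AE_I2) auto

text \<open>Each rectangle lies in the unit square, which has measure 1, so integrating the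
  pointwise bound \<open>b\<close> over the square suffices.\<close>

lemma cut_norm_le:
  assumes b: "\<And>z. z \<in> unit_square \<Longrightarrow> \<bar>U z\<bar> \<le> b" "0 \<le> b"
  shows "cut_norm U \<le> b"
proof -
  have "\<bar>LINT z:(S \<times> T)|lebesgue. U z\<bar> \<le> b" if "S \<subseteq> {0..1}" "T \<subseteq> {0..1}" for S T :: "real set"
  proof (cases "set_integrable lebesgue (S \<times> T) U")
    case True
    have cb: "unit_square = cbox (0, 0) (1, 1)"
      by (simp add: cbox_Pair_eq del: cbox_interval)
    have sq: "unit_square \<in> lmeasurable" "measure lebesgue unit_square = 1"
      unfolding cb by (simp, simp add: content_Pair)
    have "\<bar>LINT z:(S \<times> T)|lebesgue. U z\<bar> \<le> (LINT z|lebesgue. \<bar>indicator (S \<times> T) z * U z\<bar>)"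
      unfolding set_lebesgue_integral_def real_scaleR_def by (rule integral_abs_bound)
    also have "\<dots> \<le> (LINT z|lebesgue. b * indicator unit_square z)"
    proof (rule integral_mono)
      show "integrable lebesgue (\<lambda>z. \<bar>indicator (S \<times> T) z * U z\<bar>)"
        using True by (simp add: set_integrable_def)
      show "integrable lebesgue (\<lambda>z. b * indicator unit_square z)"
        using sq by (intro integrable_mult_right integrable_real_indicator) (auto simp: fmeasurable_def)
      show "\<bar>indicator (S \<times> T) z * U z\<bar> \<le> b * indicator unit_square z" for z
        using b that by (auto simp: indicator_def)
    qed
    also have "\<dots> = b" using sq by simp
    finally show ?thesis .
  next
    \<comment> \<open>The integral of a non-integrable function is 0 by convention, so
      \<open>0 \<le> b\<close> settles this case.\<close>
    case False
    then show ?thesis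
      using b by (simp add: set_lebesgue_integral_def set_integrable_def not_integrable_integral_eq)
  qed
  then show ?thesis
    unfolding cut_norm_def by (intro cSUP_least) auto
qed

theorem theorem3:
  fixes k :: nat and V :: "'a set" and E :: "'a set set"
  assumes "k \<ge> 3"
    and "simple_graph V E"
    and "has_odd_girth E"
  shows "\<not> locally_common k V E"
proof
  assume "locally_common k V E"
  then obtain \<epsilon> where \<epsilon>: "\<epsilon> > 0" and common: "\<And>W :: nat \<Rightarrow> real \<times> real \<Rightarrow> real.
      \<lbrakk>\<forall>i\<in>{1..k}. graphon (W i); \<forall>z\<in>unit_square. (\<Sum>i=1..k. W i z) = 1;
       \<forall>i\<in>{1..k}. cut_norm (\<lambda>z. W i z - 1 / real k) \<le> \<epsilon> / real k;
       \<forall>i\<in>{1..k}. sup_norm (\<lambda>z. W i z - 1 / real k) \<le> ereal (1 / real k)\<rbrakk> \<Longrightarrow>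
      (\<Sum>i=1..k. hom_density V E (W i)) \<ge> real k powi (- int (card E) + 1)"
    unfolding locally_common_def by blast
  define g where "g = girth E"
  obtain p where p: "is_cycle E p" and g: "odd g"
    using assms(3) by (auto simp: has_odd_girth_def g_def)
  have g3: "g \<ge> 3" using three_le_girth[OF p] by (simp add: g_def)
  have finE: "finite E"
    using assms(2) by (auto simp: simple_graph_def intro: finite_subset[of E "Pow V"])
  define \<F> where "\<F> = {F. F \<subseteq> E \<and> even_subgraph F}"
  have fin: "finite \<F>" using finE by (simp add: \<F>_def)
  have empty: "{} \<in> \<F>" by (simp add: \<F>_def even_subgraph_def)
  define P where "P c = (\<Sum>F\<in>\<F>. c ^ card F)" for c :: real
  \<comment> \<open>The cofactor of \<open>c ^ g\<close> in \<open>P c - 1\<close>. The girth bound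
    ensures that the subtraction in the exponent is never truncated.\<close>
  define Q where "Q c = (\<Sum>F\<in>\<F> - {{}}. c ^ (card F - g))" for c :: real
  have PQ: "P c = 1 + c ^ g * Q c" for c
  proof -
    have "c ^ card F = c ^ g * c ^ (card F - g)" if "F \<in> \<F> - {{}}" for F
      using that girth_le_card_even_subgraph[OF assms(2), of F]
      by (simp add: \<F>_def g_def flip: power_add)
    then show ?thesis
      by (simp add: P_def Q_def sum.remove[OF fin empty] sum_distrib_left)
  qed
  \<comment> \<open>Since \<open>0 ^ 0 = 1\<close>, the value \<open>Q 0\<close> counts the even
    subgraphs with exactly \<open>g\<close> edges.\<close>
  have Q0: "Q 0 > 0"
  proof -
    obtain F where F: "F \<subseteq> E" "even_subgraph F" "card F = g"
      using ex_even_subgraph_card_girth[OF p] by (metis g_def)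
    then have "F \<in> \<F> - {{}}" using g3 by (auto simp: \<F>_def)
    then show ?thesis
      unfolding Q_def using F fin by (intro sum_pos2[of _ F]) auto
  qed
  \<comment> \<open>As \<open>g\<close> is odd, \<open>2 * P d + P (-2 * d)\<close> equals 3 plus
    \<open>d ^ g\<close> times this expression. Its limit at 0 is \<open>(2 - 2 ^ g) * Q 0\<close>,
    so continuity yields a suitable small \<open>d\<close>.\<close>
  have "((\<lambda>d. 2 * Q d - 2 ^ g * Q (-2 * d)) \<longlongrightarrow> 2 * Q 0 - 2 ^ g * Q (-2 * 0)) (at_right 0)"
    unfolding Q_def by (intro tendsto_intros)
  moreover have "2 * Q 0 - 2 ^ g * Q (-2 * 0) < 0"
  proof -
    have "(2::real) ^ 1 < 2 ^ g" using g3 by (intro power_strict_increasing) auto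
    then show ?thesis using Q0 by simp
  qed
  ultimately have "eventually (\<lambda>d. 2 * Q d - 2 ^ g * Q (-2 * d) < 0) (at_right 0)"
    by (rule order_tendstoD(2))
  \<comment> \<open>The largest perturbation has size \<open>2 * d\<close>. It must be at most 1 for
    the graphon and supremum conditions and at most \<epsilon> for the cut norm.\<close>
  moreover have "eventually (\<lambda>d::real. d \<in> {0<..<min (1/2) (\<epsilon>/2)}) (at_right 0)"
    using \<epsilon> by (intro eventually_at_right_real) simp
  ultimately have "\<exists>d. 2 * Q d - 2 ^ g * Q (-2 * d) < 0 \<and> d \<in> {0<..<min (1/2) (\<epsilon>/2)}"
    using eventually_happens'[OF _ eventually_conj] trivial_limit_at_right_real by blast
  then obtain d where d: "0 < d" "d < 1/2" "d < \<epsilon>/2" and neg: "2 * Q d - 2 ^ g * Q (-2 * d) < 0"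
    by auto
  define c where "c i = (if i = 1 \<or> i = 2 then d else if i = 3 then -2 * d else 0)" for i :: nat
  define W where "W i z = sign_kernel (c i) z / real k" for i z
  have split: "{1..k} = {1, 2, 3} \<union> {4..k}" using assms(1) by auto
  \<comment> \<open>Applied to the sign kernel this shows that the graphons sum to 1; applied to
    \<open>P\<close> it gives the total density.\<close>
  have sum_c: "(\<Sum>i=1..k. f (c i)) = 2 * f d + f (-2 * d) + (real k - 3) * f 0" for f :: "real \<Rightarrow> real"
  proof -
    have "(\<Sum>i=4..k. f (c i)) = (\<Sum>i=4..k. f 0)" by (intro sum.cong) (auto simp: c_def)
    then show ?thesis
      unfolding split using assms(1) by (subst sum.union_disjoint) (auto simp: c_def of_nat_diff)
  qed
  have c_le: "\<bar>c i\<bar> \<le> 1" "\<bar>c i\<bar> \<le> \<epsilon>" for i using d by (auto simp: c_def)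
  have abs_W: "\<bar>W i z - 1 / real k\<bar> = \<bar>c i\<bar> / real k" for i z
    using abs_sign_kernel_minus_1[of "c i" z] unfolding W_def
    by (simp add: abs_divide flip: diff_divide_distrib)
  have "real k powi (- int (card E) + 1) \<le> (\<Sum>i=1..k. hom_density V E (W i))"
  proof (rule common; intro ballI)
    fix i
    show "graphon (W i)"
      unfolding W_def using c_le assms(1) by (intro graphon_sign_kernel) auto
    show "cut_norm (\<lambda>z. W i z - 1 / real k) \<le> \<epsilon> / real k"
      using c_le \<epsilon> by (intro cut_norm_le) (auto simp: abs_W divide_right_mono)
    have "(\<lambda>z. W i z - 1 / real k) \<in> borel_measurable (lebesgue_on unit_square)"
      unfolding W_def using sign_kernel_lebesgue_on
      by (intro borel_measurable_diff borel_measurable_divide) auto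
    then show "sup_norm (\<lambda>z. W i z - 1 / real k) \<le> ereal (1 / real k)"
      using c_le by (intro sup_norm_le) (auto simp: abs_W divide_right_mono)
  next
    fix z :: "real \<times> real"
    have "(\<Sum>i=1..k. W i z) = (\<Sum>i=1..k. sign_kernel (c i) z) / real k"
      by (simp add: W_def sum_divide_distrib)
    also have "\<dots> = 1"
      using assms(1) unfolding sum_c[of "\<lambda>c. sign_kernel c z"] by (simp add: sign_kernel_def)
    finally show "(\<Sum>i=1..k. W i z) = 1" .
  qed
  also have "(\<Sum>i=1..k. hom_density V E (W i)) = (\<Sum>i=1..k. P (c i)) / real k ^ card E"
    unfolding W_def hom_density_sign_kernel[OF assms(2)] P_def \<F>_def sum_divide_distrib ..
  \<comment> \<open>Each of the \<open>k\<close> terms contributes its constant 1. The unperturbed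
    ones contribute nothing else, because \<open>0 ^ g = 0\<close>.\<close>
  also have "(\<Sum>i=1..k. P (c i)) = real k + d ^ g * (2 * Q d - 2 ^ g * Q (-2 * d))"
    unfolding sum_c using g g3
    by (simp add: PQ power_minus_odd power_mult_distrib algebra_simps)
  also have "\<dots> / real k ^ card E < real k / real k ^ card E"
    using assms(1) d neg by (intro divide_strict_right_mono) (auto simp: mult_pos_neg)
  also have "\<dots> = real k powi (- int (card E) + 1)"
    using assms(1) by (subst power_int_add) (simp_all add: power_int_minus divide_inverse)
  finally show False by simp
qed

end
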